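(* Let $\overline{D},d,c_S,s_S,c_F,s_F>0$ satisfy $d>\overline{D}$, $c_F>c_S\overline{D}+s_S$, $s_F>s_S$ and $c_F>2s_S$ (so that the equilibrium commitment $k^*$ under perfect virtual trading satisfies $k^*>0$). Then perfect virtual trading improves cost efficiency compared to no virtual trading: $$Cost(k^* )<Cost(0)=s_Sd+\frac{\overline{D}}{4}(c_F+s_F),$$ where $Cost(k)$ is the total expected cost when $k$ slow-start resources are committed in day-ahead.
   Context: Model. There is a day-ahead (DA) market followed by a real-time (RT) market. Inelastic demand is $d$ in DA and $d+\epsilon$ in RT, where $\epsilon$ is uniformly distributed on $[-\overline{D},\overline{D}]$. There is a base-load slow-start unit of capacity $d$ with marginal cost $0$ and fixed cost $s_S d$; a continuum of slow-start resources (SSR) with total cost $C_S(q)=\frac{c_S}{2}q^2+s_Sq$, which can be used in RT only if committed in DA (their start-up cost is then sunk); and a continuum of fast-start resources (FSR) with total cost $C_F(q)=c_Fq+s_Fq$, which can be started in RT. If an amount $k\in[0,\overline{D}]$ of SSR is committed in DA, the total expected cost is $$Cost(k)=s_Sd+s_Sk+\frac{1}{2\overline{D}}\Big(\int_0^k\frac{c_S}{2}\epsilon^2\,d\epsilon+\int_k^{\overline{D}}\Big[\frac{c_Sk^2}{2}+(c_F+s_F)(\epsilon-k)\Big]d\epsilon\Big).$$ No virtual trading corresponds to $k=0$. Perfect virtual trading: virtual traders set the DA price, $p_{DA}(k)=c_Sk+s_S$, and the expected RT price is $\mathbb{E}_\epsilon(p_{RT,\epsilon})(k)=\frac{1}{2\overline{D}}\big(\int_0^kc_S\epsilon\,d\epsilon+\int_k^{\overline{D}}c_F\,d\epsilon\big)$.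 The equilibrium commitment $k^*$ is the $k\in[0,\overline{D}]$ satisfying the no-arbitrage condition $p_{DA}(k)=\mathbb{E}_\epsilon(p_{RT,\epsilon})(k)$, equivalently the root in $[0,\overline{D}]$ of $\frac{c_S}{2}k^2-(c_F+2c_S\overline{D})k+\overline{D}(c_F-2s_S)=0$. *)

theory Defs
  imports "HOL-Analysis.Analysis"
begin

text \<open>
  Parameters: \<open>D\<close> is the half-width of the support of the real-time demand shock, which is
  uniform on \<open>{-D..D}\<close>; \<open>d\<close> is the day-ahead demand; \<open>c\<^sub>S, s\<^sub>S\<close> are the cost coefficients of
  slow-start resources, with total cost \<open>c\<^sub>S / 2 * q\<^sup>2 + s\<^sub>S * q\<close>; \<open>c\<^sub>F, s\<^sub>F\<close> those of fast-start
  resources, with total cost \<open>c\<^sub>F * q + s\<^sub>F * q\<close>; \<open>k\<close> is the amount of slow-start resources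
  committed in day-ahead.
\<close>

text \<open>
  Shocks \<open>\<epsilon> \<le> 0\<close> are absorbed by the base-load unit at marginal cost \<open>0\<close>, so they
  contribute neither to the expected cost nor to the expected real-time price: the integrals
  below range over \<open>{0..D}\<close> only, while the density remains \<open>1 / (2 * D)\<close>.
  The term \<open>s\<^sub>S * d\<close> is the fixed cost of the base-load unit, whose capacity is \<open>d\<close>.
\<close>

definition expected_cost ::
  "real \<Rightarrow> real \<Rightarrow> real \<Rightarrow> real \<Rightarrow> real \<Rightarrow> real \<Rightarrow> real \<Rightarrow> real" where
  "expected_cost D d c\<^sub>S s\<^sub>S c\<^sub>F s\<^sub>F k =
     s\<^sub>S * d + s\<^sub>S * k
     + 1 / (2 * D) *
       (integral {0..k} (\<lambda>\<epsilon>. c\<^sub>S / 2 * \<epsilon>\<^sup>2)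
        + integral {k..D} (\<lambda>\<epsilon>. c\<^sub>S * k\<^sup>2 / 2 + (c\<^sub>F + s\<^sub>F) * (\<epsilon> - k)))"

definition da_price :: "real \<Rightarrow> real \<Rightarrow> real \<Rightarrow> real" where
  "da_price c\<^sub>S s\<^sub>S k = c\<^sub>S * k + s\<^sub>S"

definition expected_rt_price :: "real \<Rightarrow> real \<Rightarrow> real \<Rightarrow> real \<Rightarrow> real" where
  "expected_rt_price D c\<^sub>S c\<^sub>F k =
     1 / (2 * D) * (integral {0..k} (\<lambda>\<epsilon>. c\<^sub>S * \<epsilon>) + integral {k..D} (\<lambda>\<epsilon>. c\<^sub>F))"

definition equilibrium_commitment ::
  "real \<Rightarrow> real \<Rightarrow> real \<Rightarrow> real \<Rightarrow> real \<Rightarrow> bool" where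
  "equilibrium_commitment D c\<^sub>S s\<^sub>S c\<^sub>F k \<longleftrightarrow>
     k \<in> {0..D} \<and> da_price c\<^sub>S s\<^sub>S k = expected_rt_price D c\<^sub>S c\<^sub>F k"

end

theory Submission
  imports Defs
begin

text \<open>
  All integrands are polynomials, so on \<open>0 \<le> k \<le> D\<close> both the cost and the no-arbitrage condition
  are polynomial in \<open>k\<close>. The spread between the expected real-time price and the day-ahead price
  is, up to the factor \<open>2 * D\<close>, a quadratic that is strictly decreasing on \<open>{0..D}\<close>, positive at
  \<open>0\<close> (because \<open>c\<^sub>F > 2 * s\<^sub>S\<close>) and negative at \<open>D\<close>. It therefore has exactly one root there, and
  that root is positive.

  The cost saving at the root comes out of the no-arbitrage condition itself. The
  price equation expresses the start-up cost rate \<open>s\<^sub>S\<close> through the other parameters, and after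
  this substitution the cost at \<open>k\<close> minus the cost at \<open>0\<close> is \<open>k / (2 * D)\<close> times
  \<open>c\<^sub>S * k\<^sup>2 / 6 - 3 * c\<^sub>S * D * k / 2 - c\<^sub>F * k / 2 - s\<^sub>F * (D - k / 2)\<close>.
  For \<open>0 < k \<le> D\<close> the only positive term is the first one, and the second one dominates it.
\<close>

lemma integral_polynomials_on_interval:
  fixes a b m n :: real
  assumes "a \<le> b"
  shows "integral {a..b} (\<lambda>x. m * x) = m * (b\<^sup>2 - a\<^sup>2) / 2"
    and "integral {a..b} (\<lambda>x. m * x\<^sup>2) = m * (b ^ 3 - a ^ 3) / 3"
    and "integral {a..b} (\<lambda>x. n + m * (x - a)) = n * (b - a) + m * (b - a)\<^sup>2 / 2"
proof -
  have "((\<lambda>x. m * x) has_integral m * b\<^sup>2 / 2 - m * a\<^sup>2 / 2) {a..b}"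
    by (rule fundamental_theorem_of_calculus[OF assms])
       (auto intro!: derivative_eq_intros simp flip: has_real_derivative_iff_has_vector_derivative)
  from integral_unique[OF this] show "integral {a..b} (\<lambda>x. m * x) = m * (b\<^sup>2 - a\<^sup>2) / 2"
    by (simp only: right_diff_distrib diff_divide_distrib)
  have "((\<lambda>x. m * x\<^sup>2) has_integral m * b ^ 3 / 3 - m * a ^ 3 / 3) {a..b}"
    by (rule fundamental_theorem_of_calculus[OF assms])
       (auto intro!: derivative_eq_intros simp flip: has_real_derivative_iff_has_vector_derivative)
  from integral_unique[OF this] show "integral {a..b} (\<lambda>x. m * x\<^sup>2) = m * (b ^ 3 - a ^ 3) / 3"
    by (simp only: right_diff_distrib diff_divide_distrib)
  have "((\<lambda>x. n + m * (x - a)) has_integral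
      (n * (b - a) + m * (b - a)\<^sup>2 / 2) - (n * (a - a) + m * (a - a)\<^sup>2 / 2)) {a..b}"
    by (rule fundamental_theorem_of_calculus[OF assms])
       (auto intro!: derivative_eq_intros simp flip: has_real_derivative_iff_has_vector_derivative)
  then show "integral {a..b} (\<lambda>x. n + m * (x - a)) = n * (b - a) + m * (b - a)\<^sup>2 / 2"
    by (simp add: integral_unique)
qed

lemma expected_cost_closed_form:
  assumes "0 \<le> k" "k \<le> D"
  shows "expected_cost D d c\<^sub>S s\<^sub>S c\<^sub>F s\<^sub>F k =
    s\<^sub>S * d + s\<^sub>S * k
    + (c\<^sub>S * k ^ 3 / 6 + c\<^sub>S * k\<^sup>2 / 2 * (D - k) + (c\<^sub>F + s\<^sub>F) * (D - k)\<^sup>2 / 2) / (2 * D)"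
  unfolding expected_cost_def integral_polynomials_on_interval(2)[OF assms(1)]
    integral_polynomials_on_interval(3)[OF assms(2)]
  by simp

text \<open>On \<open>{0..D}\<close> this is the price spread \<open>expected_rt_price - da_price\<close>, scaled by \<open>2 * D\<close>.\<close>

definition scaled_spread :: "real \<Rightarrow> real \<Rightarrow> real \<Rightarrow> real \<Rightarrow> real \<Rightarrow> real" where
  "scaled_spread D c\<^sub>S s\<^sub>S c\<^sub>F k =
     c\<^sub>S / 2 * k\<^sup>2 - (c\<^sub>F + 2 * c\<^sub>S * D) * k + D * (c\<^sub>F - 2 * s\<^sub>S)"

lemma equilibrium_commitment_iff_root:
  assumes "D > 0"
  shows "equilibrium_commitment D c\<^sub>S s\<^sub>S c\<^sub>F k \<longleftrightarrow>
    k \<in> {0..D} \<and> scaled_spread D c\<^sub>S s\<^sub>S c\<^sub>F k = 0"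
proof -
  have "2 * D * (expected_rt_price D c\<^sub>S c\<^sub>F k - da_price c\<^sub>S s\<^sub>S k) = scaled_spread D c\<^sub>S s\<^sub>S c\<^sub>F k"
    if "k \<in> {0..D}"
    using that assms
    by (simp add: expected_rt_price_def da_price_def scaled_spread_def
        integral_polynomials_on_interval field_simps power2_eq_square)
  then show ?thesis
    using assms unfolding equilibrium_commitment_def by fastforce
qed

text \<open>
  The vertex of the quadratic lies at \<open>2 * D + c\<^sub>F / c\<^sub>S\<close>, to the right of the interval.
\<close>

lemma scaled_spread_strictly_decreasing:
  assumes "c\<^sub>S > 0" "c\<^sub>F > 0" "0 \<le> x" "x < y" "y \<le> D"
  shows "scaled_spread D c\<^sub>S s\<^sub>S c\<^sub>F y < scaled_spread D c\<^sub>S s\<^sub>S c\<^sub>F x"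
proof -
  have "c\<^sub>S * (x + y) \<le> c\<^sub>S * (2 * D)"
    using assms by (intro mult_left_mono) auto
  moreover have "c\<^sub>S * D > 0"
    using assms by simp
  ultimately have "c\<^sub>S / 2 * (x + y) - (c\<^sub>F + 2 * c\<^sub>S * D) < 0"
    using assms(2) by (simp add: algebra_simps)
  then have "(y - x) * (c\<^sub>S / 2 * (x + y) - (c\<^sub>F + 2 * c\<^sub>S * D)) < 0"
    using assms by (intro mult_pos_neg) auto
  then show ?thesis
    by (simp add: scaled_spread_def field_simps power2_eq_square)
qed

lemma ex1_equilibrium_commitment:
  assumes "D > 0" "c\<^sub>S > 0" "s\<^sub>S \<ge> 0" "c\<^sub>F > 2 * s\<^sub>S"
  shows "\<exists>!k. equilibrium_commitment D c\<^sub>S s\<^sub>S c\<^sub>F k"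
proof -
  let ?q = "scaled_spread D c\<^sub>S s\<^sub>S c\<^sub>F"
  have "?q D = - (3 / 2 * (c\<^sub>S * D\<^sup>2) + 2 * (s\<^sub>S * D))"
    by (simp add: scaled_spread_def field_simps power2_eq_square)
  moreover have "c\<^sub>S * D\<^sup>2 \<ge> 0" "s\<^sub>S * D \<ge> 0"
    using assms by auto
  ultimately have "?q D \<le> 0"
    by linarith
  moreover have "0 \<le> ?q 0"
    using assms by (simp add: scaled_spread_def)
  moreover have "continuous_on {0..D} ?q"
    unfolding scaled_spread_def by (intro continuous_intros)
  ultimately obtain k where k: "0 \<le> k" "k \<le> D" "?q k = 0"
    using IVT2'[of ?q D 0 0] assms by auto
  have unique: "x = y" if "x \<in> {0..D}" "?q x = 0" "y \<in> {0..D}" "?q y = 0" for x y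
    using that scaled_spread_strictly_decreasing[of c\<^sub>S c\<^sub>F x y D s\<^sub>S]
      scaled_spread_strictly_decreasing[of c\<^sub>S c\<^sub>F y x D s\<^sub>S] assms
    by (cases x y rule: linorder_cases) auto
  show ?thesis
    unfolding equilibrium_commitment_iff_root[OF assms(1)]
    using k unique by (metis atLeastAtMost_iff)
qed

lemma equilibrium_commitment_pos:
  assumes "D > 0" "c\<^sub>F > 2 * s\<^sub>S" "equilibrium_commitment D c\<^sub>S s\<^sub>S c\<^sub>F k"
  shows "k > 0"
proof -
  have "scaled_spread D c\<^sub>S s\<^sub>S c\<^sub>F 0 \<noteq> 0"
    using assms by (simp add: scaled_spread_def)
  then show ?thesis
    using assms by (cases "k = 0") (auto simp: equilibrium_commitment_iff_root)
qed

text \<open>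
  Eliminating \<open>s\<^sub>S\<close> by means of the no-arbitrage condition leaves an expression whose sign can be
  read off term by term.
\<close>

lemma equilibrium_cost_difference:
  assumes "D > 0" "equilibrium_commitment D c\<^sub>S s\<^sub>S c\<^sub>F k"
  shows "expected_cost D d c\<^sub>S s\<^sub>S c\<^sub>F s\<^sub>F k - expected_cost D d c\<^sub>S s\<^sub>S c\<^sub>F s\<^sub>F 0 =
    k / (2 * D) *
      (c\<^sub>S * k\<^sup>2 / 6 - 3 * c\<^sub>S * D * k / 2 - c\<^sub>F * k / 2 - s\<^sub>F * (D - k / 2))"
    (is "?diff = k / (2 * D) * ?r")
proof -
  have k: "0 \<le> k" "k \<le> D" and root: "scaled_spread D c\<^sub>S s\<^sub>S c\<^sub>F k = 0"
    using assms by (auto simp: equilibrium_commitment_iff_root)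
  \<comment> \<open>Before the price condition is used, the two sides differ by a multiple of the spread.\<close>
  have "2 * D * ?diff = k * (?r - scaled_spread D c\<^sub>S s\<^sub>S c\<^sub>F k)"
    using k assms(1)
    by (simp add: expected_cost_closed_form scaled_spread_def field_simps
        power2_eq_square power3_eq_cube)
  then show ?thesis
    using root assms(1) by (simp add: field_simps)
qed

lemma equilibrium_cost_less:
  assumes "D > 0" "c\<^sub>S > 0" "c\<^sub>F > 0" "s\<^sub>F > 0" "c\<^sub>F > 2 * s\<^sub>S"
    and eq: "equilibrium_commitment D c\<^sub>S s\<^sub>S c\<^sub>F k"
  shows "expected_cost D d c\<^sub>S s\<^sub>S c\<^sub>F s\<^sub>F k < expected_cost D d c\<^sub>S s\<^sub>S c\<^sub>F s\<^sub>F 0"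
proof -
  have "k > 0"
    using equilibrium_commitment_pos assms by blast
  have "k \<le> D"
    using eq by (simp add: equilibrium_commitment_def)
  have "c\<^sub>S * k * k \<le> c\<^sub>S * k * D"
    using \<open>k > 0\<close> \<open>k \<le> D\<close> assms by (intro mult_left_mono) auto
  moreover have "c\<^sub>S * k * D > 0" "c\<^sub>F * k > 0" "s\<^sub>F * (D - k / 2) > 0"
    using \<open>k > 0\<close> \<open>k \<le> D\<close> assms by auto
  moreover have "c\<^sub>S * k\<^sup>2 / 6 - 3 * c\<^sub>S * D * k / 2 = c\<^sub>S * k * k / 6 - 3 / 2 * (c\<^sub>S * k * D)"
    by (simp add: power2_eq_square algebra_simps)
  ultimately have "c\<^sub>S * k\<^sup>2 / 6 - 3 * c\<^sub>S * D * k / 2 - c\<^sub>F * k / 2 - s\<^sub>F * (D - k / 2) < 0"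
    by linarith
  moreover have "k / (2 * D) > 0"
    using \<open>k > 0\<close> assms by simp
  ultimately have
    "expected_cost D d c\<^sub>S s\<^sub>S c\<^sub>F s\<^sub>F k - expected_cost D d c\<^sub>S s\<^sub>S c\<^sub>F s\<^sub>F 0 < 0"
    unfolding equilibrium_cost_difference[OF assms(1) eq] by (intro mult_pos_neg)
  then show ?thesis
    by simp
qed

theorem proposition4:
  fixes D d c\<^sub>S s\<^sub>S c\<^sub>F s\<^sub>F :: real
  assumes "D > 0" and "d > 0" and "c\<^sub>S > 0" and "s\<^sub>S > 0" and "c\<^sub>F > 0" and "s\<^sub>F > 0"
    and "d > D"
    and "c\<^sub>F > c\<^sub>S * D + s\<^sub>S"
    and "s\<^sub>F > s\<^sub>S"
    and "c\<^sub>F > 2 * s\<^sub>S"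
  shows "(\<exists>!k. equilibrium_commitment D c\<^sub>S s\<^sub>S c\<^sub>F k)
    \<and> (\<forall>k. equilibrium_commitment D c\<^sub>S s\<^sub>S c\<^sub>F k \<longrightarrow>
          k > 0 \<and> expected_cost D d c\<^sub>S s\<^sub>S c\<^sub>F s\<^sub>F k < expected_cost D d c\<^sub>S s\<^sub>S c\<^sub>F s\<^sub>F 0)
    \<and> expected_cost D d c\<^sub>S s\<^sub>S c\<^sub>F s\<^sub>F 0 = s\<^sub>S * d + D / 4 * (c\<^sub>F + s\<^sub>F)"
proof (intro conjI allI impI)
  show "\<exists>!k. equilibrium_commitment D c\<^sub>S s\<^sub>S c\<^sub>F k"
    using assms by (intro ex1_equilibrium_commitment) auto
  show "k > 0" if "equilibrium_commitment D c\<^sub>S s\<^sub>S c\<^sub>F k" for k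
    using equilibrium_commitment_pos that assms by blast
  show "expected_cost D d c\<^sub>S s\<^sub>S c\<^sub>F s\<^sub>F k < expected_cost D d c\<^sub>S s\<^sub>S c\<^sub>F s\<^sub>F 0"
    if "equilibrium_commitment D c\<^sub>S s\<^sub>S c\<^sub>F k" for k
    using equilibrium_cost_less that assms by blast
  show "expected_cost D d c\<^sub>S s\<^sub>S c\<^sub>F s\<^sub>F 0 = s\<^sub>S * d + D / 4 * (c\<^sub>F + s\<^sub>F)"
    using assms by (simp add: expected_cost_closed_form field_simps power2_eq_square)
qed

end
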